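(* For any $k\ge 32$ and any constant $\varepsilon$ with $1/k\le\varepsilon\le 1/32$ such that $\varepsilon k$ is a power of $2$, every deterministic online algorithm for the online graph partitioning problem (with $\ell$ servers of capacity $k$, online capacity $(1+\varepsilon)k$) has competitive ratio $\Omega(\ell\log k)$.
   Context: Online graph partitioning problem: There is a vertex set $V$ with $|V|=\ell\cdot k$. Initially each vertex is assigned to one of $\ell$ servers so that every server holds exactly $k$ vertices, and the graph $G=(V,E)$ has $E=\emptyset$. Edges of $G$ are then revealed one by one in an online fashion. The request sequence is guaranteed to be such that at all times there exists an assignment of vertices to servers in which each server holds at most $k$ vertices and every connected component of the current graph lies entirely on one server. After each edge insertion, an online algorithm must (possibly) move vertices between servers so that every connected component of the revealed graph lies entirely on a single server (cc-condition), while each server holds at most $(1+\varepsilon)k$ vertices. Each vertex move costs $1/k$. The optimal offline algorithm $\mathrm{OPT}$ knows the whole sequence in advance and must keep at most $k$ vertices per server; its cost is the minimum total cost of moves needed. The (strict) competitive ratio of a deterministic online algorithm $\mathrm{ONL}$ is the supremum over adversarially chosen request sequences of $\mathrm{cost}(\mathrm{ONL})/\mathrm{cost}(\mathrm{OPT})$. *)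

theory Defs
  imports Complex_Main "HOL-Library.Extended_Nonnegative_Real"
begin

text \<open>Vertices are natural numbers and the servers are \<open>0, \<dots>, \<ell> - 1\<close>. An edge is a two-element
  set of vertices. An assignment is a function from vertices to servers; only its values on the
  vertex set \<open>V\<close> matter.\<close>

type_synonym edge = "nat set"
type_synonym assignment = "nat \<Rightarrow> nat"

definition component :: "nat set \<Rightarrow> edge set \<Rightarrow> nat \<Rightarrow> nat set" where
  "component V E v = {u \<in> V. (v, u) \<in> {(x, y). {x, y} \<in> E}\<^sup>*}"

definition components :: "nat set \<Rightarrow> edge set \<Rightarrow> nat set set" where
  "components V E = component V E ` V"

definition load :: "nat set \<Rightarrow> assignment \<Rightarrow> nat \<Rightarrow> nat" where
  "load V f s = card {v \<in> V. f v = s}"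

definition valid_assignment ::
  "nat set \<Rightarrow> nat \<Rightarrow> real \<Rightarrow> edge set \<Rightarrow> assignment \<Rightarrow> bool" where
  "valid_assignment V l cap E f \<longleftrightarrow>
     f ` V \<subseteq> {..<l} \<and>
     (\<forall>s<l. real (load V f s) \<le> cap) \<and>
     (\<forall>C\<in>components V E. \<exists>s<l. \<forall>v\<in>C. f v = s)"

definition initial_assignment :: "nat set \<Rightarrow> nat \<Rightarrow> nat \<Rightarrow> assignment \<Rightarrow> bool" where
  "initial_assignment V l k f \<longleftrightarrow> f ` V \<subseteq> {..<l} \<and> (\<forall>s<l. load V f s = k)"

definition requests :: "nat set \<Rightarrow> nat \<Rightarrow> nat \<Rightarrow> edge list set" where
  "requests V l k = {\<sigma>. distinct \<sigma> \<and> (\<forall>e\<in>set \<sigma>. e \<subseteq> V \<and> card e = 2) \<and>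
     (\<forall>i\<le>length \<sigma>. \<exists>f. valid_assignment V l (real k) (set (take i \<sigma>)) f)}"

text \<open>In a schedule \<open>A\<close> for a request sequence, \<open>A i\<close> is the assignment after the first \<open>i\<close>
  requests have been served.\<close>

definition valid_schedule ::
  "nat set \<Rightarrow> nat \<Rightarrow> real \<Rightarrow> assignment \<Rightarrow> edge list \<Rightarrow> (nat \<Rightarrow> assignment) \<Rightarrow> bool" where
  "valid_schedule V l cap init \<sigma> A \<longleftrightarrow>
     (\<forall>v\<in>V. A 0 v = init v) \<and>
     (\<forall>i\<le>length \<sigma>. valid_assignment V l cap (set (take i \<sigma>)) (A i))"

definition schedule_cost :: "nat set \<Rightarrow> nat \<Rightarrow> edge list \<Rightarrow> (nat \<Rightarrow> assignment) \<Rightarrow> real" where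
  "schedule_cost V k \<sigma> A =
     (\<Sum>i<length \<sigma>. real (card {v \<in> V. A (Suc i) v \<noteq> A i v}) / real k)"

definition opt_cost :: "nat set \<Rightarrow> nat \<Rightarrow> nat \<Rightarrow> assignment \<Rightarrow> edge list \<Rightarrow> real" where
  "opt_cost V l k init \<sigma> =
     (INF A \<in> {A. valid_schedule V l (real k) init \<sigma> A}. schedule_cost V k \<sigma> A)"

text \<open>A deterministic online algorithm maps the sequence of edges revealed so far to its current
  assignment.\<close>

type_synonym algorithm = "edge list \<Rightarrow> assignment"

definition run :: "algorithm \<Rightarrow> edge list \<Rightarrow> nat \<Rightarrow> assignment" where
  "run ONL \<sigma> i = ONL (take i \<sigma>)"

definition online_algorithm ::
  "nat set \<Rightarrow> nat \<Rightarrow> nat \<Rightarrow> real \<Rightarrow> assignment \<Rightarrow> algorithm \<Rightarrow> bool" where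
  "online_algorithm V l k \<epsilon> init ONL \<longleftrightarrow>
     (\<forall>\<sigma>\<in>requests V l k. valid_schedule V l ((1 + \<epsilon>) * real k) init \<sigma> (run ONL \<sigma>))"

text \<open>In \<open>ennreal\<close>, \<open>x / 0 = \<infinity>\<close> for \<open>x > 0\<close> and \<open>0 / 0 = 0\<close>. So sequences on which
  neither side pays do not contribute to the supremum, and a positive online cost against
  optimal cost zero makes the ratio infinite.\<close>

definition competitive_ratio ::
  "nat set \<Rightarrow> nat \<Rightarrow> nat \<Rightarrow> assignment \<Rightarrow> algorithm \<Rightarrow> ennreal" where
  "competitive_ratio V l k init ONL =
     (SUP \<sigma> \<in> requests V l k.
        ennreal (schedule_cost V k \<sigma> (run ONL \<sigma>)) / ennreal (opt_cost V l k init \<sigma>))"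

end

theory Submission
  imports Defs "HOL-Library.Disjoint_Sets"
begin

text \<open>Let \<open>u = 2\<^sup>p\<close> be the largest power of two with \<open>32 u \<le> k\<close>, so that the online algorithm has at
  most \<open>u\<close> spare places per server. The adversary first glues all but \<open>4 u\<close> vertices of each server
  (all but \<open>2 u\<close> on servers 0 and 1) into one large component, its base. The remaining vertices form
  \<open>l - 1\<close> groups of size \<open>4 u\<close>, the first of which joins the leftovers of servers 0 and 1. By
  counting, at every time some group has at most \<open>3 u\<close> of its vertices on any one server. In such a
  group the adversary merges two components of the smallest size \<open>2\<^sup>i\<close>, on different servers if
  possible, which costs at least \<open>2\<^sup>i\<close> moves. This is impossible only once components of total size at
  least \<open>u\<close> have been merged at the current size, so raising a group from size \<open>2\<^sup>i\<close> to \<open>2\<^sup>i\<^sup>+\<^sup>1\<close> costs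
  at least \<open>u / 2\<close> moves. The game goes on until every group consists of components of size at least
  \<open>2 u\<close>, for a cost of \<open>(l - 1) (p + 1) u / 2\<close> moves. Then one group still splits into two halves
  of size \<open>2 u\<close>, and the offline algorithm gets by with \<open>8 u\<close> moves by putting these halves on
  servers 0 and 1 from the start.\<close>

section \<open>Assignments that are constant along edges\<close>

definition edge_constant :: "edge set \<Rightarrow> assignment \<Rightarrow> bool" where
  "edge_constant E f \<longleftrightarrow> (\<forall>e\<in>E. \<forall>x\<in>e. \<forall>y\<in>e. f x = f y)"

text \<open>Encodes that \<open>X\<close> lies in one connected component without mentioning paths:
  functions that respect all edges cannot separate its points.\<close>

definition spans :: "edge set \<Rightarrow> nat set \<Rightarrow> bool" where
  "spans E X \<longleftrightarrow> (\<forall>f. edge_constant E f \<longrightarrow> (\<forall>x\<in>X. \<forall>y\<in>X. f x = f y))"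

lemma edge_constantI:
  "(\<And>e x y. e \<in> E \<Longrightarrow> x \<in> e \<Longrightarrow> y \<in> e \<Longrightarrow> f x = f y) \<Longrightarrow> edge_constant E f"
  unfolding edge_constant_def by (intro ballI)

lemma edge_constantD: "edge_constant E f \<Longrightarrow> e \<in> E \<Longrightarrow> x \<in> e \<Longrightarrow> y \<in> e \<Longrightarrow> f x = f y"
  unfolding edge_constant_def by (drule bspec, assumption)+

lemma edge_constant_mono: "edge_constant E' f \<Longrightarrow> E \<subseteq> E' \<Longrightarrow> edge_constant E f"
  by (rule edge_constantI, erule edge_constantD) auto

lemma spansI:
  "(\<And>f x y. edge_constant E f \<Longrightarrow> x \<in> X \<Longrightarrow> y \<in> X \<Longrightarrow> f x = f y) \<Longrightarrow> spans E X"
  unfolding spans_def by (intro allI impI ballI)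

lemma spansD: "spans E X \<Longrightarrow> edge_constant E f \<Longrightarrow> x \<in> X \<Longrightarrow> y \<in> X \<Longrightarrow> f x = f y"
  unfolding spans_def by (drule spec, drule (1) mp, (drule (1) bspec)+)

lemma spans_mono: "spans E X \<Longrightarrow> E \<subseteq> E' \<Longrightarrow> spans E' X"
  by (rule spansI) (rule spansD, assumption, rule edge_constant_mono)

lemma spans_Un_edge:
  assumes "spans E X" "spans E Y" "x \<in> X" "y \<in> Y"
  shows "spans (insert {x, y} E) (X \<union> Y)"
proof (rule spansI)
  fix f a b assume f: "edge_constant (insert {x, y} E) f" and ab: "a \<in> X \<union> Y" "b \<in> X \<union> Y"
  have "f x = f y" using edge_constantD[OF f, of "{x, y}"] by simp
  have f': "edge_constant E f" using f by (rule edge_constant_mono) auto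
  have "f c = f x" if "c \<in> X \<union> Y" for c
    using that spansD[OF assms(1) f' _ assms(3)] spansD[OF assms(2) f' _ assms(4)] \<open>f x = f y\<close>
    by auto
  then show "f a = f b" using ab by simp
qed

text \<open>Trades components for edges: a shared value travels along paths by induction, and
  conversely the endpoints of an edge lie in a common component.\<close>

lemma valid_assignment_iff:
  assumes E: "\<And>e. e \<in> E \<Longrightarrow> e \<subseteq> V \<and> card e = 2"
  shows "valid_assignment V l cap E f \<longleftrightarrow>
    f ` V \<subseteq> {..<l} \<and> (\<forall>s<l. real (load V f s) \<le> cap) \<and> edge_constant E f"
proof -
  have "edge_constant E f" if C: "\<forall>C\<in>components V E. \<exists>s<l. \<forall>v\<in>C. f v = s"
  proof (rule edge_constantI)
    fix e x y assume e: "e \<in> E" "x \<in> e" "y \<in> e"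
    have xy: "x \<in> V" "y \<in> V" using E[OF e(1)] e by auto
    have "(x, y) \<in> {(x, y). {x, y} \<in> E}\<^sup>*"
    proof (cases "x = y")
      case False
      then have "{x, y} = e"
        using E[OF e(1)] e by (intro card_subset_eq) (auto intro: card_ge_0_finite)
      then show ?thesis using e by auto
    qed auto
    then have "x \<in> component V E x" "y \<in> component V E x"
      using xy by (auto simp: component_def)
    moreover have "component V E x \<in> components V E" using xy by (auto simp: components_def)
    ultimately show "f x = f y" using C by metis
  qed
  moreover have "\<forall>C\<in>components V E. \<exists>s<l. \<forall>v\<in>C. f v = s"
    if f: "edge_constant E f" "f ` V \<subseteq> {..<l}"
  proof
    fix C assume "C \<in> components V E"
    then obtain v where v: "v \<in> V" "C = component V E v" by (auto simp: components_def)
    have edge: "f x = f y" if "{x, y} \<in> E" for x y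
      using f(1) that by (rule edge_constantD) auto
    have reach: "f w = f v" if "(v, w) \<in> {(x, y). {x, y} \<in> E}\<^sup>*" for w
      using that by (induction rule: rtrancl_induct) (auto dest: edge)
    show "\<exists>s<l. \<forall>v\<in>C. f v = s"
      using v f(2) by (intro exI[of _ "f v"]) (auto simp: component_def intro: reach)
  qed
  ultimately show ?thesis unfolding valid_assignment_def by blast
qed

section \<open>Partitions into blocks of two consecutive dyadic sizes\<close>

text \<open>The level is not unique: if all blocks have size \<open>2 ^ Suc i\<close>, both
  \<open>i\<close> and \<open>Suc i\<close> qualify, so a group climbs a level without any change of
  state.\<close>

definition dyadic_level :: "nat \<Rightarrow> nat set set \<Rightarrow> bool" where
  "dyadic_level i P \<longleftrightarrow> (\<forall>X\<in>P. card X = 2 ^ i \<or> card X = 2 ^ Suc i)"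

text \<open>The potential of a group whose components have sizes \<open>2\<^sup>i\<close> and \<open>2\<^sup>i\<^sup>+\<^sup>1\<close>, \<open>i \<le> p\<close>, is \<open>i\<close> times \<open>2\<^sup>p\<close>
  plus the volume of the larger components, capped at \<open>2\<^sup>p\<close>. The sum below expresses this without
  reference to \<open>i\<close>; it is at most twice the number of moves that the group has caused.\<close>

definition big_volume :: "nat \<Rightarrow> nat set set \<Rightarrow> nat" where
  "big_volume q P = (\<Sum>X\<in>P. if 2 ^ q \<le> card X then card X else 0)"

definition potential :: "nat \<Rightarrow> nat set set \<Rightarrow> nat" where
  "potential p P = (\<Sum>i\<le>p. min (2 ^ p) (big_volume (Suc i) P))"

definition merge :: "nat set \<Rightarrow> nat set \<Rightarrow> nat set set \<Rightarrow> nat set set" where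
  "merge X Y P = insert (X \<union> Y) (P - {X, Y})"

lemma partition_on_card_sum:
  assumes "partition_on A P" "finite A" "R \<subseteq> P"
  shows "card (\<Union>R) = (\<Sum>X\<in>R. card X)"
proof (rule card_Union_disjoint)
  show "pairwise disjnt R"
    using assms by (metis partition_on_def pairwise_subset disjoint_def pairwise_def disjnt_def)
  show "finite X" if "X \<in> R" for X
    using that assms by (metis partition_onD1 Union_upper finite_subset subsetD)
qed

section \<open>Merging two blocks of the smallest size\<close>

context
  fixes A :: "nat set" and P X Y i
  assumes A: "finite A" "partition_on A P" and lev: "dyadic_level i P"
    and XY: "X \<in> P" "Y \<in> P" "X \<noteq> Y" "card X = 2 ^ i" "card Y = 2 ^ i"
begin

lemma card_merged_block: "card (X \<union> Y) = 2 ^ Suc i"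
proof -
  have "X \<inter> Y = {}" using A XY by (auto simp: partition_on_def disjoint_def)
  moreover have "finite X" "finite Y" using XY by (auto intro: card_ge_0_finite)
  ultimately show ?thesis using XY by (simp add: card_Un_disjoint)
qed

lemma partition_on_merge: "partition_on A (merge X Y P)"
proof -
  have "Z \<inter> (X \<union> Y) = {}" if "Z \<in> P - {X, Y}" for Z
    using that A XY by (auto simp: partition_on_def disjoint_def)
  then show ?thesis using A XY unfolding partition_on_def merge_def
    by (auto simp: disjoint_def)
qed

lemma dyadic_level_merge: "dyadic_level i (merge X Y P)"
  using lev card_merged_block by (auto simp: dyadic_level_def merge_def)

text \<open>Only the threshold \<open>Suc i\<close> notices the merge: lower thresholds counted both
  blocks already, higher ones still miss the union.\<close>

lemma big_volume_merge:
  "big_volume q (merge X Y P) = big_volume q P + (if q = Suc i then 2 ^ Suc i else 0)"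
proof -
  define R where "R = P - {X, Y}"
  have fin: "finite R" using A finite_elements by (auto simp: R_def)
  have P: "P = insert X (insert Y R)" using XY by (auto simp: R_def)
  \<comment> \<open>Ensures that \<open>insert\<close> adds a new summand. A block equal to the
    union would differ from \<open>X\<close>, hence be disjoint from it, making \<open>X\<close>
    empty.\<close>
  have "X \<union> Y \<notin> R"
  proof
    assume Z: "X \<union> Y \<in> R"
    moreover have "X \<union> Y \<noteq> X" using card_merged_block XY(4) by auto
    ultimately have "(X \<union> Y) \<inter> X = {}"
      using disjointD[OF partition_onD2[OF A(2)], of "X \<union> Y" X] XY(1) by (auto simp: R_def)
    then show False using A XY by (auto simp: partition_on_def)
  qed
  then have m: "big_volume q (merge X Y P) =
      (if 2 ^ q \<le> (2::nat) ^ Suc i then 2 ^ Suc i else 0) + big_volume q R"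
    using fin card_merged_block by (simp add: big_volume_def merge_def flip: R_def)
  have o: "big_volume q P = (if 2 ^ q \<le> (2::nat) ^ i then 2 ^ Suc i else 0) + big_volume q R"
    using fin XY unfolding big_volume_def P by (subst sum.insert, auto simp: R_def)
  have le: "(2::nat) ^ q \<le> 2 ^ j \<longleftrightarrow> q \<le> j" for j by simp
  show ?thesis unfolding m o le by auto
qed

text \<open>The increase is twice the size of one merged block; hence the factor 2 between potential
  and moves.\<close>

lemma potential_merge_le: "potential p (merge X Y P) \<le> potential p P + 2 ^ Suc i"
proof -
  have "potential p (merge X Y P) \<le>
      (\<Sum>j\<le>p. min (2 ^ p) (big_volume (Suc j) P) + (if j = i then 2 ^ Suc i else 0))"
    unfolding potential_def big_volume_merge by (intro sum_mono) auto
  also have "\<dots> \<le> potential p P + 2 ^ Suc i"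
    by (simp add: potential_def sum.distrib)
  finally show ?thesis .
qed

text \<open>The cap \<open>2 ^ p\<close> absorbs the only term that could grow, so a merge that
  costs the online algorithm nothing does no harm to the accounting.\<close>

lemma potential_merge_eq:
  "2 ^ p \<le> big_volume (Suc i) P \<Longrightarrow> potential p (merge X Y P) = potential p P"
  unfolding potential_def big_volume_merge by (intro sum.cong) auto

end

text \<open>Block sizes are powers of two above \<open>2 ^ p\<close>, so at least
  \<open>2 ^ Suc p\<close>. Each of the \<open>Suc p\<close> thresholds then counts all of
  \<open>A\<close>, and its term reaches the cap.\<close>

lemma potential_saturated:
  assumes A: "finite A" "partition_on A P" "2 ^ p \<le> card A"
    and lev: "dyadic_level i P" and big: "\<And>X. X \<in> P \<Longrightarrow> 2 ^ p < card X"
  shows "potential p P = Suc p * 2 ^ p"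
proof -
  have X: "2 ^ Suc p \<le> card X" if X: "X \<in> P" for X
  proof -
    have "card X = 2 ^ i \<or> card X = 2 ^ Suc i" using lev X by (auto simp: dyadic_level_def)
    then obtain j where j: "card X = 2 ^ j" by blast
    then have "p < j" using big[OF X] by simp
    then show ?thesis unfolding j by (intro power_increasing) auto
  qed
  have "big_volume (Suc j) P = card A" if "j \<le> p" for j
  proof -
    have "(2::nat) ^ Suc j \<le> 2 ^ Suc p" using that by (intro power_increasing) auto
    then have "2 ^ Suc j \<le> card X" if "X \<in> P" for X using X[OF that] by (rule le_trans)
    then have "big_volume (Suc j) P = (\<Sum>X\<in>P. card X)"
      unfolding big_volume_def by (intro sum.cong) simp_all
    also have "\<dots> = card A"
      using partition_on_card_sum[OF A(2,1) order_refl] A by (simp add: partition_on_def)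
    finally show ?thesis .
  qed
  then show ?thesis using A(3) by (simp add: potential_def)
qed

section \<open>Counting the blocks of either size\<close>

lemma dyadic_level_card_split:
  assumes A: "finite A" "partition_on A P" and lev: "dyadic_level i P"
  shows "card {X \<in> P. card X = 2 ^ i} * 2 ^ i + card {X \<in> P. card X = 2 ^ Suc i} * 2 ^ Suc i
    = card A"
proof -
  let ?S = "{X \<in> P. card X = 2 ^ i}" and ?L = "{X \<in> P. card X = 2 ^ Suc i}"
  have "finite P" using A finite_elements by blast
  have "P = ?S \<union> ?L" using lev by (auto simp: dyadic_level_def)
  then have "(\<Sum>X\<in>P. card X) = (\<Sum>X\<in>?S \<union> ?L. card X)"
    by (rule arg_cong[where f = "sum card"])
  also have "\<dots> = (\<Sum>X\<in>?S. card X) + (\<Sum>X\<in>?L. card X)"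
    by (rule sum.union_disjoint) (use \<open>finite P\<close> in auto)
  finally have "(\<Sum>X\<in>P. card X) = (\<Sum>X\<in>?S. card X) + (\<Sum>X\<in>?L. card X)" .
  moreover have "(\<Sum>X\<in>P. card X) = card A"
    using partition_on_card_sum[OF A(2,1) order_refl] A by (simp add: partition_on_def)
  ultimately show ?thesis by simp
qed

text \<open>A surviving small block certifies that \<open>dyadic_level_halve\<close> still applies
  to its group.\<close>

lemma dyadic_level_le:
  assumes "dyadic_level i P" "Z \<in> P" "card Z \<le> 2 ^ p"
  shows "i \<le> p"
proof -
  have "(2::nat) ^ i \<le> card Z" using assms(1,2) by (auto simp: dyadic_level_def)
  then have "(2::nat) ^ i \<le> 2 ^ p" using assms(3) by (rule le_trans)
  then show ?thesis by (rule power_le_imp_le_exp[rotated]) simp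
qed

text \<open>In units of \<open>2 ^ i\<close> the set has size \<open>4 * d\<close>. If there are
  \<open>d\<close> large blocks, they make a half; otherwise there are more than
  \<open>2 * d\<close> small blocks, enough to complete the large ones to a half.\<close>

lemma dyadic_level_halve:
  assumes A: "finite A" "partition_on A P" "card A = 4 * 2 ^ p"
    and lev: "dyadic_level i P" "i \<le> p"
  obtains R where "R \<subseteq> P" "card (\<Union>R) = 2 * 2 ^ p"
proof -
  let ?S = "{X \<in> P. card X = 2 ^ i}" and ?L = "{X \<in> P. card X = 2 ^ Suc i}"
  have fin: "finite P" using A finite_elements by blast
  define d where "d = (2::nat) ^ (p - i)"
  have p: "(2::nat) ^ p = d * 2 ^ i" using lev(2) by (simp add: d_def flip: power_add)
  have "(card ?S + 2 * card ?L) * 2 ^ i = (4 * d) * 2 ^ i"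
    using dyadic_level_card_split[OF A(1,2) lev(1)] A(3) p by (simp add: algebra_simps)
  then have tot: "card ?S + 2 * card ?L = 4 * d" by simp
  show thesis
  proof (cases "card ?L \<ge> d")
    case True
    then obtain R where R: "R \<subseteq> ?L" "card R = d" "finite R"
      by (rule obtain_subset_with_card_n)
    have "card (\<Union>R) = (\<Sum>X\<in>R. card X)"
      using R by (intro partition_on_card_sum[OF A(2,1)]) auto
    also have "\<dots> = (\<Sum>X\<in>R. 2 ^ Suc i)" using R by (intro sum.cong) auto
    finally have "card (\<Union>R) = card R * 2 ^ Suc i" by simp
    then show thesis using R p by (intro that[of R]) auto
  next
    case False
    then have "2 * d - 2 * card ?L \<le> card ?S" using tot by simp
    then obtain R where R: "R \<subseteq> ?S" "card R = 2 * d - 2 * card ?L" "finite R"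
      by (rule obtain_subset_with_card_n)
    have "card (\<Union>(R \<union> ?L)) = (\<Sum>X\<in>R \<union> ?L. card X)"
      using R by (intro partition_on_card_sum[OF A(2,1)]) auto
    also have "\<dots> = (\<Sum>X\<in>R. card X) + (\<Sum>X\<in>?L. card X)"
      using R fin by (intro sum.union_disjoint) auto
    also have "(\<Sum>X\<in>R. card X) = (\<Sum>X\<in>R. 2 ^ i)" using R by (intro sum.cong) auto
    also have "(\<Sum>X\<in>R. 2 ^ i) + (\<Sum>X\<in>?L. card X) = (card R + 2 * card ?L) * 2 ^ i"
      by (simp add: algebra_simps)
    also have "card R + 2 * card ?L = 2 * d" using R(2) False by simp
    finally show thesis using R p by (intro that[of "R \<union> ?L"]) auto
  qed
qed

text \<open>By volume, the number of blocks of size \<open>2 ^ i\<close> is even, so at least two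
  once it is nonzero. If they all share one server, their volume is at most
  \<open>3 * 2 ^ p\<close>, which leaves at least \<open>2 ^ p\<close> to the large blocks.\<close>

lemma mergeable_blocks:
  assumes A: "finite A" "partition_on A P" "card A = 4 * 2 ^ p"
    and lev: "dyadic_level i0 P"
    and spread: "\<And>t. card {v \<in> A. f v = t} \<le> 3 * 2 ^ p"
    and const: "\<And>X x y. X \<in> P \<Longrightarrow> x \<in> X \<Longrightarrow> y \<in> X \<Longrightarrow> f x = f y"
  obtains i X Y where "dyadic_level i P" "X \<in> P" "Y \<in> P" "X \<noteq> Y"
    "card X = 2 ^ i" "card Y = 2 ^ i"
    "(\<forall>x\<in>X. \<forall>y\<in>Y. f x \<noteq> f y) \<or> 2 ^ p \<le> big_volume (Suc i) P"
proof -
  have "A \<noteq> {}" using A(3) by auto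
  then obtain X0 where X0: "X0 \<in> P" using A(2) by (auto simp: partition_on_def)
  \<comment> \<open>If no block of size \<open>2 ^ i0\<close> is left, the level is raised by one,
    so that \<open>2 ^ i\<close> is the size of an actual block.\<close>
  obtain i X where i: "dyadic_level i P" and X: "X \<in> P" "card X = 2 ^ i"
  proof (cases "\<exists>X\<in>P. card X = 2 ^ i0")
    case False
    then have "dyadic_level (Suc i0) P" "card X0 = 2 ^ Suc i0"
      using lev X0 by (auto simp: dyadic_level_def)
    then show thesis using that X0 by blast
  qed (use lev that in blast)
  let ?S = "{X \<in> P. card X = 2 ^ i}" and ?L = "{X \<in> P. card X = 2 ^ Suc i}"
  have fin: "finite P" using A finite_elements by blast
  have XA: "X \<subseteq> A" using A X by (auto simp: partition_on_def)
  have "X \<noteq> {}" using A X by (auto simp: partition_on_def)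
  then obtain x where x: "x \<in> X" by auto
  have "X \<subseteq> {v \<in> A. f v = f x}" using x XA by (auto intro: const[OF X(1)])
  then have "card X \<le> card {v \<in> A. f v = f x}" using A(1) by (intro card_mono) auto
  also have "\<dots> \<le> 3 * 2 ^ p" by (rule spread)
  also have "\<dots> < 2 ^ (p + 2)" by (simp add: power_add)
  finally have "(2::nat) ^ i < 2 ^ (p + 2)" using X by simp
  then have "i < p + 2" by (rule power_less_imp_less_exp[rotated]) simp
  then have ip: "i \<le> Suc p" by simp
  have tot: "card ?S * 2 ^ i + card ?L * 2 ^ Suc i = 4 * 2 ^ p"
    using dyadic_level_card_split[OF A(1,2) i] A(3) by simp
  \<comment> \<open>The bound \<open>i <= Suc p\<close> makes \<open>d\<close> an exact quotient;
    the volume is then \<open>2 * d\<close> units, which gives the parity of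
    \<open>card ?S\<close>.\<close>
  define d where "d = (2::nat) ^ (Suc p - i)"
  have p: "2 * (2::nat) ^ p = d * 2 ^ i"
    using ip by (simp add: d_def flip: power_add power_Suc)
  have "(card ?S + 2 * card ?L) * 2 ^ i = (2 * d) * 2 ^ i"
    using tot p by (simp add: algebra_simps)
  then have "card ?S + 2 * card ?L = 2 * d" by simp
  then have "even (card ?S)" by presburger
  moreover have "card ?S \<noteq> 0" using X fin by auto
  ultimately have "card ?S \<ge> 2" by presburger
  then have "card (?S - {X}) > 0" using X fin by (simp add: card_Diff_singleton)
  then have "?S - {X} \<noteq> {}" by (intro notI) simp
  then obtain Y0 where Y0: "Y0 \<in> P" "card Y0 = 2 ^ i" "Y0 \<noteq> X" by auto
  show thesis
  proof (cases "\<exists>Y\<in>?S. \<exists>y\<in>Y. f y \<noteq> f x")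
    case True
    then obtain Y y where Y: "Y \<in> ?S" "y \<in> Y" "f y \<noteq> f x" by blast
    have "f a \<noteq> f b" if "a \<in> X" "b \<in> Y" for a b
      using const[OF X(1) that(1) x] const[OF _ that(2) Y(2)] Y by simp
    moreover have "X \<noteq> Y" using const[OF X(1) _ x, of y] Y by auto
    ultimately show thesis using that[OF i X(1), of Y] X(2) Y(1) by simp
  next
    case False
    have "\<Union>?S \<subseteq> {v \<in> A. f v = f x}" using False A by (auto simp: partition_on_def)
    then have "card (\<Union>?S) \<le> card {v \<in> A. f v = f x}" using A(1) by (intro card_mono) auto
    then have "card (\<Union>?S) \<le> 3 * 2 ^ p" using spread by (rule le_trans)
    moreover have "card (\<Union>?S) = card ?S * 2 ^ i"
      by (subst partition_on_card_sum[OF A(2,1)]) auto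
    ultimately have "2 ^ p \<le> card ?L * 2 ^ Suc i" using tot by linarith
    also have "\<dots> = (\<Sum>X\<in>?L. if 2 ^ Suc i \<le> card X then card X else 0)" by simp
    also have "\<dots> \<le> big_volume (Suc i) P"
      unfolding big_volume_def using fin by (intro sum_mono2) auto
    finally show thesis using that[OF i X(1) Y0(1)] X(2) Y0(2,3) by simp
  qed
qed

section \<open>The vertex groups\<close>

locale partition_game =
  fixes V :: "nat set" and l k :: nat and init :: assignment and p :: nat and Q :: "nat \<Rightarrow> nat set"
  assumes finite_V: "finite V" and l_ge_2: "2 \<le> l" and k_ge: "32 * 2 ^ p \<le> k"
    and initial: "initial_assignment V l k init"
    and Q_subset: "\<And>s. s < l \<Longrightarrow> Q s \<subseteq> {v \<in> V. init v = s}"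
    and card_Q: "\<And>s. s < l \<Longrightarrow> card (Q s) = (if s < 2 then 2 * 2 ^ p else 4 * 2 ^ p)"
begin

definition base :: "nat \<Rightarrow> nat set" where
  "base s = {v \<in> V. init v = s} - Q s"

text \<open>Groups are indexed by \<open>{1..<l}\<close>. The reserves of servers 0 and 1 are only
  half as large and share index 1.\<close>

definition group :: "nat \<Rightarrow> nat set" where
  "group j = (if j = 1 then Q 0 \<union> Q 1 else Q j)"

lemma init_less: "v \<in> V \<Longrightarrow> init v < l"
  using initial by (auto simp: initial_assignment_def)

lemma card_home: "s < l \<Longrightarrow> card {v \<in> V. init v = s} = k"
  using initial by (auto simp: initial_assignment_def load_def)

lemma finite_base: "finite (base s)"
  using finite_V by (simp add: base_def)

lemma base_subset: "base s \<subseteq> V"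
  by (auto simp: base_def)

lemma card_base: "s < l \<Longrightarrow> card (base s) + (if s < 2 then 2 * 2 ^ p else 4 * 2 ^ p) = k"
proof -
  assume s: "s < l"
  have "finite (Q s)" using Q_subset[OF s] finite_V by (auto intro: finite_subset)
  then have "card (base s) = k - card (Q s)"
    unfolding base_def using Q_subset[OF s] card_home[OF s] by (simp add: card_Diff_subset)
  moreover have "card (Q s) \<le> k" using card_Q[OF s] k_ge by auto
  ultimately show ?thesis using card_Q[OF s] by simp
qed

lemma card_base_ge: "s < l \<Longrightarrow> k \<le> card (base s) + 4 * 2 ^ p"
  using card_base[of s] by (auto split: if_splits)

lemma base_nonempty: "s < l \<Longrightarrow> base s \<noteq> {}"
proof
  assume "s < l" "base s = {}"
  then have "k \<le> 4 * 2 ^ p" using card_base_ge[of s] by simp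
  then show False using k_ge zero_less_power[of "2::nat" p] by linarith
qed

lemma base_disjoint: "s \<noteq> t \<Longrightarrow> base s \<inter> base t = {}"
  by (auto simp: base_def)

lemma Q_init: "s < l \<Longrightarrow> v \<in> Q s \<Longrightarrow> v \<in> V \<and> init v = s"
  using Q_subset by blast

lemma group_init:
  assumes "j \<in> {1..<l}" "v \<in> group j"
  shows "v \<in> V" "v \<in> Q (init v)" "init v < 2 \<longleftrightarrow> j = 1" "j \<noteq> 1 \<Longrightarrow> init v = j"
proof -
  obtain s where s: "s < l" "v \<in> Q s" "s = j \<and> j \<noteq> 1 \<or> s < 2 \<and> j = 1"
  proof (cases "j = 1")
    case True
    then have "v \<in> Q 0 \<or> v \<in> Q 1" using assms by (simp add: group_def)
    then show thesis using that[of 0] that[of 1] True l_ge_2 by auto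
  next
    case False
    then show thesis using that[of j] assms by (simp add: group_def)
  qed
  have "v \<in> V" "init v = s" using Q_init[OF s(1,2)] by auto
  then show "v \<in> V" "v \<in> Q (init v)" "init v < 2 \<longleftrightarrow> j = 1" "j \<noteq> 1 \<Longrightarrow> init v = j"
    using s assms(1) by auto
qed

lemma group_subset: "j \<in> {1..<l} \<Longrightarrow> group j \<subseteq> V"
  using group_init(1) by (intro subsetI)

lemma finite_group: "j \<in> {1..<l} \<Longrightarrow> finite (group j)"
  using finite_subset[OF group_subset finite_V] .

lemma card_group: "j \<in> {1..<l} \<Longrightarrow> card (group j) = 4 * 2 ^ p"
proof (cases "j = 1")
  case True
  have "finite (Q 0)" "finite (Q 1)"
    using Q_subset[of 0] Q_subset[of 1] l_ge_2 finite_V by (auto intro: finite_subset)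
  moreover have "Q 0 \<inter> Q 1 = {}" using Q_init[of 0] Q_init[of 1] l_ge_2 by fastforce
  ultimately show ?thesis
    using True card_Q[of 0] card_Q[of 1] l_ge_2 by (simp add: group_def card_Un_disjoint)
qed (auto simp: group_def card_Q)

lemma group_disjoint: "i \<in> {1..<l} \<Longrightarrow> j \<in> {1..<l} \<Longrightarrow> i \<noteq> j \<Longrightarrow> group i \<inter> group j = {}"
  using group_init(3,4) by (metis disjoint_iff)

lemma base_group_disjoint: "j \<in> {1..<l} \<Longrightarrow> base s \<inter> group j = {}"
  using group_init(2) by (fastforce simp: base_def)

text \<open>The \<open>l\<close> bases sit on distinct servers, and only the \<open>l - 2\<close> servers holding a base of size
  \<open>k - 4 \<cdot> 2\<^sup>p\<close> have room for more than \<open>3 \<cdot> 2\<^sup>p\<close> further vertices, each of them for one group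
  only. As there are \<open>l - 1\<close> groups, one of them is spread out.\<close>

lemma spread_group:
  assumes f: "f ` V \<subseteq> {..<l}" "\<And>s. s < l \<Longrightarrow> load V f s \<le> k + 2 ^ p"
    and const: "\<And>s x y. s < l \<Longrightarrow> x \<in> base s \<Longrightarrow> y \<in> base s \<Longrightarrow> f x = f y"
  obtains j where "j \<in> {1..<l}" "\<forall>t. card {v \<in> group j. f v = t} \<le> 3 * 2 ^ p"
proof (rule ccontr)
  assume "\<not> thesis"
  then have "\<forall>j\<in>{1..<l}. \<exists>t. 3 * 2 ^ p < card {v \<in> group j. f v = t}"
    using that by (meson not_le)
  then obtain \<tau> where \<tau>: "\<And>j. j \<in> {1..<l} \<Longrightarrow> 3 * 2 ^ p < card {v \<in> group j. f v = \<tau> j}"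
    by metis
  have cap: "card X \<le> k + 2 ^ p" if "X \<subseteq> {v \<in> V. f v = t}" "t < l" for X t
    using card_mono[OF _ that(1)] finite_V f(2)[OF that(2)] by (simp add: load_def)
  \<comment> \<open>The server hosting base \<open>s\<close>, read off at an arbitrary point since
    \<open>f\<close> is constant there.\<close>
  define \<beta> where "\<beta> s = f (SOME x. x \<in> base s)" for s
  have \<beta>: "base s \<subseteq> {v \<in> V. f v = \<beta> s}" if "s < l" for s
    using base_subset const[OF that] some_in_eq[of "base s"] base_nonempty[OF that]
    unfolding \<beta>_def by blast
  have \<beta>_less: "\<beta> s < l" if s: "s < l" for s
  proof -
    obtain x where "x \<in> base s" using base_nonempty[OF s] by auto
    then have "x \<in> V" "f x = \<beta> s" using \<beta>[OF s] by auto
    then show ?thesis using f(1) by auto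
  qed
  \<comment> \<open>Two bases have at least \<open>2 * k - 8 * 2 ^ p\<close> vertices, more than
    \<open>k + 2 ^ p\<close>.\<close>
  have inj: "inj_on \<beta> {..<l}"
  proof (rule inj_onI, rule ccontr)
    fix s t assume st: "s \<in> {..<l}" "t \<in> {..<l}" "\<beta> s = \<beta> t" "s \<noteq> t"
    have "card (base s \<union> base t) \<le> k + 2 ^ p"
      using \<beta>[of s] \<beta>[of t] \<beta>_less[of s] st by (intro cap[of _ "\<beta> s"]) auto
    moreover have "card (base s \<union> base t) = card (base s) + card (base t)"
      using finite_base base_disjoint[OF st(4)] by (intro card_Un_disjoint)
    ultimately show False
      using card_base_ge[of s, OF st(1)[simplified]] card_base_ge[of t, OF st(2)[simplified]] k_ge
        zero_less_power[of "2::nat" p] by linarith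
  qed
  have surj: "\<beta> ` {..<l} = {..<l}"
    using inj \<beta>_less by (intro endo_inj_surj) auto
  have host: "\<exists>s<l. t = \<beta> s" if "t < l" for t
  proof -
    have "t \<in> \<beta> ` {..<l}" using surj that by simp
    then show ?thesis by auto
  qed
  have \<tau>_less: "\<tau> j < l" if "j \<in> {1..<l}" for j
  proof -
    have "{v \<in> group j. f v = \<tau> j} \<noteq> {}" using \<tau>[OF that] by (intro notI) simp
    then obtain v where v: "v \<in> group j" "f v = \<tau> j" by auto
    have "f v \<in> {..<l}" using v(1) group_subset[OF that] f(1) by (intro subsetD[OF f(1)] imageI) auto
    then show ?thesis using v(2) by simp
  qed
  have "\<tau> j \<in> \<beta> ` {2..<l}" if j: "j \<in> {1..<l}" for j
  proof -
    obtain s where s: "s < l" "\<tau> j = \<beta> s" using host[OF \<tau>_less[OF j]] by auto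
    \<comment> \<open>Bases 0 and 1 have \<open>k - 2 * 2 ^ p\<close> vertices; more than
      \<open>3 * 2 ^ p\<close> further ones exceed the capacity.\<close>
    have "s \<ge> 2"
    proof (rule ccontr)
      assume "\<not> s \<ge> 2"
      have "card (base s \<union> {v \<in> group j. f v = \<tau> j}) \<le> k + 2 ^ p"
        using \<beta>[OF s(1)] s \<tau>_less[OF j] group_subset[OF j] by (intro cap[of _ "\<tau> j"]) auto
      moreover have "card (base s \<union> {v \<in> group j. f v = \<tau> j}) =
          card (base s) + card {v \<in> group j. f v = \<tau> j}"
        using finite_base finite_group[OF j] base_group_disjoint[OF j]
        by (intro card_Un_disjoint) auto
      ultimately show False using \<tau>[OF j] card_base[OF s(1)] \<open>\<not> s \<ge> 2\<close> by simp
    qed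
    then show ?thesis using s by auto
  qed
  \<comment> \<open>Two groups on one server would bring more than \<open>6 * 2 ^ p\<close> vertices
    to a base of at least \<open>k - 4 * 2 ^ p\<close>.\<close>
  moreover have "inj_on \<tau> {1..<l}"
  proof (rule inj_onI, rule ccontr)
    fix i j assume ij: "i \<in> {1..<l}" "j \<in> {1..<l}" "\<tau> i = \<tau> j" "i \<noteq> j"
    obtain s where s: "s < l" "\<tau> j = \<beta> s" using host[OF \<tau>_less[OF ij(2)]] by auto
    let ?I = "{v \<in> group i. f v = \<tau> i}" and ?J = "{v \<in> group j. f v = \<tau> j}"
    have fin: "finite ?I" "finite ?J" using finite_group ij by auto
    have "card (base s \<union> (?I \<union> ?J)) \<le> k + 2 ^ p"
      using \<beta>[OF s(1)] s \<tau>_less[OF ij(2)] group_subset[OF ij(1)] group_subset[OF ij(2)] ij(3)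
      by (intro cap[of _ "\<tau> j"]) auto
    moreover have "card (base s \<union> (?I \<union> ?J)) = card (base s) + card (?I \<union> ?J)"
      using fin finite_base base_group_disjoint[OF ij(1), of s] base_group_disjoint[OF ij(2), of s]
      by (intro card_Un_disjoint) auto
    moreover have "card (?I \<union> ?J) = card ?I + card ?J"
      using fin group_disjoint[OF ij(1,2,4)] by (intro card_Un_disjoint) auto
    ultimately show False
      using \<tau>[OF ij(1)] \<tau>[OF ij(2)] card_base_ge[OF s(1)] by simp
  qed
  ultimately have "card {1..<l} \<le> card (\<beta> ` {2..<l})"
    by (intro card_inj_on_le[of \<tau>]) auto
  also have "\<dots> \<le> card {2..<l}" by (rule card_image_le) simp
  finally show False using l_ge_2 by simp
qed

text \<open>The offline solution puts the two halves of group \<open>h\<close> next to the small bases \<open>0\<close> and \<open>1\<close>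
  and moves group \<open>1\<close> to the server that this frees.\<close>

lemma offline_assignment:
  assumes h: "h \<in> {1..<l}" and P: "partition_on (group h) P" "dyadic_level i P" "i \<le> p"
  obtains f where "f ` V \<subseteq> {..<l}" "\<And>s. s < l \<Longrightarrow> load V f s \<le> k"
    "\<And>s x y. x \<in> base s \<Longrightarrow> y \<in> base s \<Longrightarrow> f x = f y"
    "\<And>j x y. j \<in> {1..<l} \<Longrightarrow> j \<noteq> h \<Longrightarrow> x \<in> group j \<Longrightarrow> y \<in> group j \<Longrightarrow> f x = f y"
    "\<And>X x y. X \<in> P \<Longrightarrow> x \<in> X \<Longrightarrow> y \<in> X \<Longrightarrow> f x = f y"
    "card {v \<in> V. f v \<noteq> init v} \<le> 8 * 2 ^ p"
proof -
  obtain R where R: "R \<subseteq> P" "card (\<Union>R) = 2 * 2 ^ p"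
    using dyadic_level_halve[OF finite_group[OF h] P(1) card_group[OF h] P(2,3)] .
  define H where "H = \<Union>R"
  have H: "H \<subseteq> group h" "card H = 2 * 2 ^ p"
    using R P(1) by (auto simp: H_def partition_on_def)
  have finH: "finite H" using H finite_group[OF h] by (auto intro: finite_subset)
  have one: "1 \<in> {1..<l}" using l_ge_2 by simp
  \<comment> \<open>For \<open>h = 1\<close> the third branch is never reached, and group 1 itself
    is split between servers 0 and 1.\<close>
  define f where "f v = (if v \<in> H then 0 else if v \<in> group h then 1
    else if v \<in> group 1 then h else init v)" for v
  have f_base: "f x = s" if "x \<in> base s" for x s
    using that base_group_disjoint[OF h, of s] base_group_disjoint[OF one, of s] H(1)
    by (auto simp: f_def base_def)
  have f_group: "f x = (if j = 1 then h else j)" if "j \<in> {1..<l}" "j \<noteq> h" "x \<in> group j" for x j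
    using that group_disjoint[OF that(1) h that(2)] group_disjoint[OF that(1) one] H(1)
      group_init(4)[OF that(1,3)] by (auto simp: f_def)
  have f_block: "f x = (if X \<in> R then 0 else 1)" if "X \<in> P" "x \<in> X" for x X
  proof -
    have "x \<in> group h" using that P(1) by (auto simp: partition_on_def)
    moreover have "x \<in> H \<longleftrightarrow> X \<in> R"
      using that R(1) disjointD[OF partition_onD2[OF P(1)], of X] unfolding H_def by blast
    ultimately show ?thesis by (simp add: f_def)
  qed
  have home: "v \<in> base (init v)" if "v \<in> V" "v \<notin> group 1" "init v < 2" for v
  proof -
    have "init v = 0 \<or> init v = 1" using that(3) by auto
    then show ?thesis using that by (auto simp: base_def group_def)
  qed
  have load: "load V f s \<le> k" if s: "s < l" for s
  proof -
    \<comment> \<open>On servers 0 and 1 a half group fills the gap beside the base, on server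
      \<open>h >= 2\<close> group 1 replaces group \<open>h\<close>, and the other servers gain
      nothing.\<close>
    have "\<exists>X. {v \<in> V. f v = s} \<subseteq> X \<and> finite X \<and> card X \<le> k"
    proof -
      consider "s = 0" | "s = 1" | "s \<ge> 2" "s = h" | "s \<ge> 2" "s \<noteq> h" by linarith
      then show ?thesis
      proof cases
        case 1
        have "v \<in> base 0 \<union> H" if "v \<in> V" "f v = 0" for v
          using home[OF that(1)] that(2) h by (auto simp: f_def split: if_splits)
        then have "{v \<in> V. f v = s} \<subseteq> base 0 \<union> H" using 1 by blast
        moreover have "card (base 0 \<union> H) \<le> k"
          using card_Un_le[of "base 0" H] card_base[of 0] H(2) l_ge_2 by simp
        ultimately show ?thesis using finite_base finH by blast
      next
        case 2
        have "v \<in> base 1 \<union> (group h - H)" if v: "v \<in> V" "f v = 1" for v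
        proof (cases "v \<in> group h")
          case True
          then show ?thesis using v(2) by (auto simp: f_def)
        next
          case False
          then have "v \<notin> group 1" "init v = 1"
            using H(1) v(2) by (auto simp: f_def split: if_splits)
          then show ?thesis using home[OF v(1)] by simp
        qed
        then have "{v \<in> V. f v = s} \<subseteq> base 1 \<union> (group h - H)" using 2 by blast
        moreover have "card (group h - H) = 2 * 2 ^ p"
          using card_Diff_subset[OF finH H(1)] H(2) card_group[OF h] by simp
        then have "card (base 1 \<union> (group h - H)) \<le> k"
          using card_Un_le[of "base 1" "group h - H"] card_base[of 1] l_ge_2 by simp
        ultimately show ?thesis using finite_base finite_group[OF h] by blast
      next
        case 3
        have "{v \<in> V. f v = s} \<subseteq> base h \<union> group 1"
          using 3 by (auto simp: f_def base_def group_def split: if_splits)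
        moreover have "card (base h \<union> group 1) \<le> k"
          using card_Un_le[of "base h" "group 1"] card_base[of h] card_group[OF one] 3 s by simp
        ultimately show ?thesis using finite_base finite_group[OF one] by blast
      next
        case 4
        have "{v \<in> V. f v = s} \<subseteq> {v \<in> V. init v = s}"
          using 4 by (auto simp: f_def split: if_splits)
        then show ?thesis
          using finite_V card_home[OF s] by (intro exI[of _ "{v \<in> V. init v = s}"]) simp
      qed
    qed
    then show ?thesis unfolding load_def by (meson card_mono order_trans)
  qed
  have "card {v \<in> V. f v \<noteq> init v} \<le> card (group h \<union> group 1)"
    using H(1) finite_group[OF h] finite_group[OF one]
    by (intro card_mono) (auto simp: f_def split: if_splits)
  also have "\<dots> \<le> 8 * 2 ^ p"
    using card_Un_le[of "group h" "group 1"] card_group[OF h] card_group[OF one] by simp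
  finally have diff: "card {v \<in> V. f v \<noteq> init v} \<le> 8 * 2 ^ p" .
  have "f ` V \<subseteq> {..<l}" using init_less h l_ge_2 by (auto simp: f_def)
  then show thesis
    by (rule that) (use load diff in \<open>simp_all add: f_base f_group f_block\<close>)
qed

section \<open>Game states\<close>

text \<open>The edge clause keeps components from exceeding bases and blocks, the
  \<open>spans\<close> clauses make these connected, and the last clause keeps some group divisible
  into halves, so that the offline side stays feasible.\<close>

definition game_state :: "edge list \<Rightarrow> (nat \<Rightarrow> nat set set) \<Rightarrow> bool" where
  "game_state \<sigma> P \<longleftrightarrow> distinct \<sigma> \<and>
     (\<forall>e\<in>set \<sigma>. e \<subseteq> V \<and> card e = 2 \<and>
        ((\<exists>s<l. e \<subseteq> base s) \<or> (\<exists>j\<in>{1..<l}. \<exists>X\<in>P j. e \<subseteq> X))) \<and>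
     (\<forall>s<l. spans (set \<sigma>) (base s)) \<and>
     (\<forall>j\<in>{1..<l}. partition_on (group j) (P j) \<and> (\<exists>i. dyadic_level i (P j)) \<and>
        (\<forall>X\<in>P j. spans (set \<sigma>) X)) \<and>
     (\<exists>h\<in>{1..<l}. \<exists>i\<le>p. dyadic_level i (P h))"

lemma game_stateD:
  assumes "game_state \<sigma> P"
  shows "distinct \<sigma>" "\<And>e. e \<in> set \<sigma> \<Longrightarrow> e \<subseteq> V \<and> card e = 2"
    "\<And>e. e \<in> set \<sigma> \<Longrightarrow> (\<exists>s<l. e \<subseteq> base s) \<or> (\<exists>j\<in>{1..<l}. \<exists>X\<in>P j. e \<subseteq> X)"
    "\<And>s. s < l \<Longrightarrow> spans (set \<sigma>) (base s)"
    "\<And>j. j \<in> {1..<l} \<Longrightarrow> partition_on (group j) (P j)"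
    "\<And>j. j \<in> {1..<l} \<Longrightarrow> \<exists>i. dyadic_level i (P j)"
    "\<And>j X. j \<in> {1..<l} \<Longrightarrow> X \<in> P j \<Longrightarrow> spans (set \<sigma>) X"
    "\<exists>h\<in>{1..<l}. \<exists>i\<le>p. dyadic_level i (P h)"
  using assms unfolding game_state_def by simp_all

section \<open>Feasibility and cost of the offline solution\<close>

lemma game_state_offline:
  assumes "game_state \<sigma> P"
  obtains f where "valid_assignment V l (real k) (set \<sigma>) f"
    "card {v \<in> V. f v \<noteq> init v} \<le> 8 * 2 ^ p"
proof -
  note st = game_stateD[OF assms]
  obtain h i where h: "h \<in> {1..<l}" "i \<le> p" "dyadic_level i (P h)" using st(8) by auto
  show thesis
  proof (rule offline_assignment[OF h(1) st(5)[OF h(1)] h(3,2)])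
    fix f assume f: "f ` V \<subseteq> {..<l}" "\<And>s. s < l \<Longrightarrow> load V f s \<le> k"
      "\<And>s x y. x \<in> base s \<Longrightarrow> y \<in> base s \<Longrightarrow> f x = f y"
      "\<And>j x y. j \<in> {1..<l} \<Longrightarrow> j \<noteq> h \<Longrightarrow> x \<in> group j \<Longrightarrow> y \<in> group j \<Longrightarrow> f x = f y"
      "\<And>X x y. X \<in> P h \<Longrightarrow> x \<in> X \<Longrightarrow> y \<in> X \<Longrightarrow> f x = f y"
      "card {v \<in> V. f v \<noteq> init v} \<le> 8 * 2 ^ p"
    have "edge_constant (set \<sigma>) f"
    proof (rule edge_constantI)
      fix e x y assume e: "e \<in> set \<sigma>" "x \<in> e" "y \<in> e"
      consider s where "e \<subseteq> base s" | j X where "j \<in> {1..<l}" "X \<in> P j" "e \<subseteq> X"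
        using st(3)[OF e(1)] by auto
      then show "f x = f y"
      proof cases
        case 1
        then show ?thesis using e by (intro f(3)[of _ s]) auto
      next
        case (2 j X)
        show ?thesis
        proof (cases "j = h")
          case True
          then show ?thesis using 2 e by (intro f(5)[of X]) auto
        next
          case False
          have "X \<subseteq> group j" using st(5)[OF 2(1)] 2(2) by (auto simp: partition_on_def)
          then show ?thesis using 2 e False by (intro f(4)[of j]) auto
        qed
      qed
    qed
    then have "valid_assignment V l (real k) (set \<sigma>) f"
      using f(1,2) st(2) by (subst valid_assignment_iff) simp_all
    then show thesis using f(6) by (rule that)
  qed
qed

text \<open>An assignment respecting all edges respects those of every prefix, so one final
  assignment proves feasibility throughout.\<close>

lemma game_state_requests:
  assumes "game_state \<sigma> P"
  shows "\<sigma> \<in> requests V l k"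
proof -
  note st = game_stateD[OF assms]
  obtain f where f: "valid_assignment V l (real k) (set \<sigma>) f"
    using game_state_offline[OF assms] by metis
  have "valid_assignment V l (real k) (set (take i \<sigma>)) f" for i
  proof -
    have sub: "set (take i \<sigma>) \<subseteq> set \<sigma>" by (rule set_take_subset)
    then show ?thesis
      using f st(2) edge_constant_mono[OF _ sub] by (subst (asm) valid_assignment_iff, simp)
        (subst valid_assignment_iff, auto)
  qed
  then show ?thesis using st(1,2) unfolding requests_def by blast
qed

lemma opt_cost_le:
  assumes "game_state \<sigma> P"
  shows "opt_cost V l k init \<sigma> \<le> 8 * 2 ^ p / real k"
proof -
  note st = game_stateD[OF assms]
  obtain f where f: "valid_assignment V l (real k) (set \<sigma>) f"
    and diff: "card {v \<in> V. f v \<noteq> init v} \<le> 8 * 2 ^ p"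
    using game_state_offline[OF assms] by metis
  \<comment> \<open>All moves are made at the first request; the start \<open>init\<close> is
    prescribed and valid as no edge is present yet.\<close>
  define A where "A i = (if i = 0 then init else f)" for i :: nat
  have "valid_assignment V l (real k) (set (take i \<sigma>)) (A i)" for i
  proof (cases "i = 0")
    case True
    have "init ` V \<subseteq> {..<l}" using init_less by auto
    then show ?thesis using True card_home
      by (subst valid_assignment_iff) (auto simp: A_def load_def edge_constant_def)
  next
    case False
    have sub: "set (take i \<sigma>) \<subseteq> set \<sigma>" by (rule set_take_subset)
    then show ?thesis
      using False f st(2) edge_constant_mono[OF _ sub] by (subst (asm) valid_assignment_iff, simp)
        (subst valid_assignment_iff, auto simp: A_def)
  qed
  then have A: "valid_schedule V l (real k) init \<sigma> A"
    by (simp add: valid_schedule_def) (simp add: A_def)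
  \<comment> \<open>An infimum of reals is below its members only if the set is bounded below, here
    by 0.\<close>
  have "opt_cost V l k init \<sigma> \<le> schedule_cost V k \<sigma> A"
    unfolding opt_cost_def
    by (rule cINF_lower) (use A in \<open>auto intro!: bdd_belowI[of _ 0] sum_nonneg simp: schedule_cost_def\<close>)
  also have "\<dots> \<le> (\<Sum>i<length \<sigma>. if i = 0 then 8 * 2 ^ p / real k else 0)"
    unfolding schedule_cost_def
  proof (rule sum_mono)
    fix i
    have "real (card {v \<in> V. f v \<noteq> init v}) \<le> 8 * 2 ^ p"
      using of_nat_mono[OF diff, where 'a = real] by simp
    then show "real (card {v \<in> V. A (Suc i) v \<noteq> A i v}) / real k \<le>
        (if i = 0 then 8 * 2 ^ p / real k else 0)"
      by (simp add: A_def divide_right_mono)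
  qed
  also have "\<dots> \<le> 8 * 2 ^ p / real k" by (simp add: sum.delta)
  finally show ?thesis .
qed

text \<open>Each base is glued as a star around a chosen centre; all groups still consist of
  singletons, at level 0.\<close>

lemma initial_game_state:
  obtains \<sigma> where "game_state \<sigma> (\<lambda>j. (\<lambda>v. {v}) ` group j)"
proof -
  define c where "c s = (SOME x. x \<in> base s)" for s
  have c: "c s \<in> base s" if "s < l" for s
    using base_nonempty[OF that] by (simp add: c_def some_in_eq)
  define E where "E = (\<Union>s<l. (\<lambda>x. {c s, x}) ` (base s - {c s}))"
  have "finite E" using finite_base by (auto simp: E_def)
  then obtain \<sigma> where \<sigma>: "set \<sigma> = E" "distinct \<sigma>" using finite_distinct_list by auto
  have E: "e \<subseteq> V \<and> card e = 2 \<and> (\<exists>s<l. e \<subseteq> base s)" if e: "e \<in> E" for e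
  proof -
    obtain s x where s: "s < l" "x \<in> base s" "x \<noteq> c s" "e = {c s, x}"
      using e by (auto simp: E_def)
    then have "e \<subseteq> base s" using c by simp
    then show ?thesis using s base_subset[of s] by auto
  qed
  have span: "spans E (base s)" if s: "s < l" for s
  proof (rule spansI)
    fix f x y assume f: "edge_constant E f" and xy: "x \<in> base s" "y \<in> base s"
    have "f z = f (c s)" if "z \<in> base s" for z
    proof (cases "z = c s")
      case False
      then have "{c s, z} \<in> E" using s that by (auto simp: E_def)
      then show ?thesis using edge_constantD[OF f, of "{c s, z}"] by simp
    qed simp
    then show "f x = f y" using xy by simp
  qed
  have part: "partition_on A ((\<lambda>v. {v}) ` A)" for A :: "nat set"
    by (auto simp: partition_on_def disjoint_def)
  have level: "dyadic_level 0 ((\<lambda>v. {v}) ` A)" for A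
    by (auto simp: dyadic_level_def)
  have "1 \<in> {1..<l}" using l_ge_2 by simp
  have "game_state \<sigma> (\<lambda>j. (\<lambda>v. {v}) ` group j)"
    unfolding game_state_def \<sigma>(1)
  proof (intro conjI ballI allI impI)
    show "\<exists>h\<in>{1..<l}. \<exists>i\<le>p. dyadic_level i ((\<lambda>v. {v}) ` group h)"
      using \<open>1 \<in> {1..<l}\<close> level by blast
    show "spans E X" if "X \<in> (\<lambda>v. {v}) ` group j" for X j
      using that by (auto intro: spansI)
  qed (use E \<sigma>(2) span part level in blast)+
  then show thesis by (rule that)
qed

end

section \<open>The adversary\<close>

text \<open>Covers optimal cost 0 without a case distinction when the offline cost is replaced by
  its upper bound.\<close>

lemma ennreal_inverse_antimono: "x \<le> y \<Longrightarrow> inverse y \<le> inverse x" for x y :: ennreal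
  including ennreal.lifting by transfer (rule ereal_inverse_antimono)

text \<open>Rounding the spare room up to \<open>2 ^ p\<close> only gives the online algorithm more
  freedom.\<close>

locale partition_adversary = partition_game +
  fixes ONL :: algorithm
  assumes online: "\<And>\<sigma>. \<sigma> \<in> requests V l k \<Longrightarrow>
    valid_assignment V l (real (k + 2 ^ p)) (set \<sigma>) (ONL \<sigma>)"
begin

definition moves :: "edge list \<Rightarrow> nat" where
  "moves \<sigma> = (\<Sum>i<length \<sigma>. card {v \<in> V. ONL (take (Suc i) \<sigma>) v \<noteq> ONL (take i \<sigma>) v})"

lemma moves_snoc: "moves (\<sigma> @ [e]) = moves \<sigma> + card {v \<in> V. ONL (\<sigma> @ [e]) v \<noteq> ONL \<sigma> v}"
  by (simp add: moves_def)

lemma online_valid: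
  assumes "game_state \<sigma> P"
  shows "ONL \<sigma> ` V \<subseteq> {..<l}" "\<And>s. s < l \<Longrightarrow> load V (ONL \<sigma>) s \<le> k + 2 ^ p"
    "edge_constant (set \<sigma>) (ONL \<sigma>)"
proof -
  have "valid_assignment V l (real (k + 2 ^ p)) (set \<sigma>) (ONL \<sigma>)"
    by (rule online[OF game_state_requests[OF assms]])
  then have "ONL \<sigma> ` V \<subseteq> {..<l} \<and> (\<forall>s<l. real (load V (ONL \<sigma>) s) \<le> real (k + 2 ^ p)) \<and>
      edge_constant (set \<sigma>) (ONL \<sigma>)"
    using game_stateD(2)[OF assms] by (subst (asm) valid_assignment_iff) simp_all
  then show "ONL \<sigma> ` V \<subseteq> {..<l}" "\<And>s. s < l \<Longrightarrow> load V (ONL \<sigma>) s \<le> k + 2 ^ p"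
    "edge_constant (set \<sigma>) (ONL \<sigma>)" by (simp_all only: of_nat_le_iff)
qed

text \<open>The block \<open>Z\<close> keeps the game feasible: its group has level at most
  \<open>p\<close>, and this survives the merge even if \<open>g = h\<close>, as merging preserves
  the level \<open>i\<close>.\<close>

lemma game_state_merge:
  assumes gs: "game_state \<sigma> P" and h: "h \<in> {1..<l}" "Z \<in> P h" "card Z \<le> 2 ^ p"
    and g: "g \<in> {1..<l}" "dyadic_level i (P g)"
    and X: "X \<in> P g" "card X = 2 ^ i" "x \<in> X" and Y: "Y \<in> P g" "card Y = 2 ^ i" "y \<in> Y"
    and "X \<noteq> Y"
  shows "game_state (\<sigma> @ [{x, y}]) (P(g := merge X Y (P g)))" (is "game_state ?\<sigma> ?P")
proof -
  note st = game_stateD[OF gs]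
  note fing = finite_group[OF g(1)]
  note mrg = fing st(5)[OF g(1)] g(2) X(1) Y(1) \<open>X \<noteq> Y\<close> X(2) Y(2)
  have XYg: "X \<subseteq> group g" "Y \<subseteq> group g" using st(5)[OF g(1)] X Y by (auto simp: partition_on_def)
  have disj: "W = W'" if "W \<in> P g" "W' \<in> P g" "w \<in> W" "w \<in> W'" for W W' w
    using disjointD[OF partition_onD2[OF st(5)[OF g(1)]] that(1,2)] that(3,4) by auto
  have "x \<noteq> y" using disj[OF X(1) Y(1) X(3)] Y(3) \<open>X \<noteq> Y\<close> by auto
  have new: "{x, y} \<notin> set \<sigma>"
  proof
    assume e: "{x, y} \<in> set \<sigma>"
    consider s where "{x, y} \<subseteq> base s" | j W where "j \<in> {1..<l}" "W \<in> P j" "{x, y} \<subseteq> W"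
      using st(3)[OF e] by auto
    then show False
    proof cases
      case 1
      then show False using base_group_disjoint[OF g(1), of s] XYg X(3) by auto
    next
      case (2 j W)
      have "W \<subseteq> group j" using st(5)[OF 2(1)] 2(2) by (auto simp: partition_on_def)
      then have "j = g" using group_disjoint[OF 2(1) g(1)] 2(3) X(3) XYg(1) by auto
      then have "X = W" "Y = W" using disj[OF X(1) _ X(3)] disj[OF Y(1) _ Y(3)] 2 by auto
      then show False using \<open>X \<noteq> Y\<close> by simp
    qed
  qed
  have block: "\<exists>W'\<in>?P j. W \<subseteq> W'" if "W \<in> P j" for W j
    using that by (cases "W = X \<or> W = Y") (auto simp: merge_def)
  show ?thesis
    unfolding game_state_def
  proof (intro conjI ballI allI impI)
    show "distinct ?\<sigma>" using st(1) new by simp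
    fix e assume e: "e \<in> set ?\<sigma>"
    have xy: "{x, y} \<subseteq> V" "card {x, y} = 2"
      using XYg X(3) Y(3) group_subset[OF g(1)] \<open>x \<noteq> y\<close> by auto
    show "e \<subseteq> V" "card e = 2" using e st(2)[of e] xy by auto
    have new_edge: "\<exists>j\<in>{1..<l}. \<exists>W\<in>?P j. {x, y} \<subseteq> W"
      using g(1) X(3) Y(3) by (intro bexI[of _ g] bexI[of _ "X \<union> Y"]) (auto simp: merge_def)
    show "(\<exists>s<l. e \<subseteq> base s) \<or> (\<exists>j\<in>{1..<l}. \<exists>W\<in>?P j. e \<subseteq> W)"
    proof (cases "e = {x, y}")
      case True
      show ?thesis unfolding True using new_edge by (rule disjI2)
    next
      case False
      then have "e \<in> set \<sigma>" using e by simp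
      then show ?thesis using st(3) block by (meson order_trans)
    qed
  next
    fix s assume "s < l"
    then show "spans (set ?\<sigma>) (base s)" by (rule spans_mono[OF st(4)]) auto
  next
    fix j assume j: "j \<in> {1..<l}"
    show "partition_on (group j) (?P j)"
      using partition_on_merge[OF mrg] st(5)[OF j] by simp
    show "\<exists>i. dyadic_level i (?P j)"
      using dyadic_level_merge[OF mrg] st(6)[OF j] by auto
    fix W assume W: "W \<in> ?P j"
    show "spans (set ?\<sigma>) W"
    proof (cases "j = g \<and> W = X \<union> Y")
      case True
      have "spans (insert {x, y} (set \<sigma>)) (X \<union> Y)"
        using st(7)[OF g(1)] X Y by (intro spans_Un_edge)
      then show ?thesis using True by simp
    next
      case False
      then have "W \<in> P j" using W by (auto simp: merge_def split: if_splits)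
      then show ?thesis by (intro spans_mono[OF st(7)[OF j]]) auto
    qed
  next
    show "\<exists>h\<in>{1..<l}. \<exists>i\<le>p. dyadic_level i (?P h)"
    proof (cases "h = g")
      case True
      then have "i \<le> p" using dyadic_level_le[of i "P g" Z] g(2) h by simp
      then show ?thesis
        using dyadic_level_merge[OF mrg] g(1) by (intro bexI[of _ g] exI[of _ i]) auto
    next
      case False
      obtain i' where i': "dyadic_level i' (P h)" using st(6)[OF h(1)] by auto
      then have "i' \<le> p" using dyadic_level_le[OF _ h(2,3)] by simp
      then show ?thesis using i' False h(1) by (intro bexI[of _ h] exI[of _ i']) auto
    qed
  qed
qed

text \<open>If the potential grows, \<open>X\<close> and \<open>Y\<close> were on different servers.
  Uniting them moves one of them entirely, so \<open>2 ^ i\<close> moves pay for a growth of at most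
  \<open>2 ^ Suc i\<close>.\<close>

lemma adversary_step:
  assumes gs: "game_state \<sigma> P" and pot: "(\<Sum>j\<in>{1..<l}. potential p (P j)) \<le> 2 * moves \<sigma>"
    and h: "h \<in> {1..<l}" "Z \<in> P h" "card Z \<le> 2 ^ p"
  shows "\<exists>e P'. game_state (\<sigma> @ [e]) P' \<and>
    (\<Sum>j\<in>{1..<l}. potential p (P' j)) \<le> 2 * moves (\<sigma> @ [e])"
proof -
  note st = game_stateD[OF gs]
  note onl = online_valid[OF gs]
  obtain g where g: "g \<in> {1..<l}" "\<forall>t. card {v \<in> group g. ONL \<sigma> v = t} \<le> 3 * 2 ^ p"
    using spread_group[OF onl(1,2) spansD[OF st(4) onl(3)]] .
  obtain i0 where i0: "dyadic_level i0 (P g)" using st(6)[OF g(1)] by auto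
  obtain i X Y where i: "dyadic_level i (P g)" and XY: "X \<in> P g" "Y \<in> P g" "X \<noteq> Y"
      "card X = 2 ^ i" "card Y = 2 ^ i"
    and cost: "(\<forall>x\<in>X. \<forall>y\<in>Y. ONL \<sigma> x \<noteq> ONL \<sigma> y) \<or> 2 ^ p \<le> big_volume (Suc i) (P g)"
    using mergeable_blocks[OF finite_group[OF g(1)] st(5)[OF g(1)] card_group[OF g(1)] i0 spec[OF g(2)]
        spansD[OF st(7)[OF g(1)] onl(3)]] .
  note mrg = finite_group[OF g(1)] st(5)[OF g(1)] i XY
  have "X \<noteq> {}" "Y \<noteq> {}" using st(5)[OF g(1)] XY by (auto simp: partition_on_def)
  then obtain x y where x: "x \<in> X" and y: "y \<in> Y" by auto
  define P' where "P' = P(g := merge X Y (P g))"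
  define \<sigma>' where "\<sigma>' = \<sigma> @ [{x, y}]"
  have gs': "game_state \<sigma>' P'"
    unfolding \<sigma>'_def P'_def using game_state_merge[OF gs h g(1) i XY(1,4) x XY(2,5) y XY(3)] .
  have "(\<Sum>j\<in>{1..<l}. potential p (P' j)) =
      potential p (merge X Y (P g)) + (\<Sum>j\<in>{1..<l} - {g}. potential p (P j))"
    using g(1) by (subst sum.remove[of _ g]) (auto simp: P'_def intro!: sum.cong)
  moreover have "(\<Sum>j\<in>{1..<l}. potential p (P j)) =
      potential p (P g) + (\<Sum>j\<in>{1..<l} - {g}. potential p (P j))"
    using g(1) by (intro sum.remove) auto
  moreover have "potential p (merge X Y (P g)) \<le>
      potential p (P g) + 2 * card {v \<in> V. ONL \<sigma>' v \<noteq> ONL \<sigma> v}"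
  proof (cases "2 ^ p \<le> big_volume (Suc i) (P g)")
    case True
    then show ?thesis using potential_merge_eq[OF mrg] by simp
  next
    case False
    have "spans (set \<sigma>') (X \<union> Y)"
      using game_stateD(7)[OF gs' g(1)] by (auto simp: P'_def merge_def)
    then have same: "ONL \<sigma>' v = ONL \<sigma>' x" if "v \<in> X \<union> Y" for v
      using spansD[OF _ online_valid(3)[OF gs'] that, of x] x by simp
    have V: "X \<subseteq> V" "Y \<subseteq> V"
      using st(5)[OF g(1)] XY group_subset[OF g(1)] by (auto simp: partition_on_def)
    let ?D = "{v \<in> V. ONL \<sigma>' v \<noteq> ONL \<sigma> v}"
    \<comment> \<open>Unmoved points on both sides would have shared a server before the
      request.\<close>
    have "X \<subseteq> ?D \<or> Y \<subseteq> ?D"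
    proof (rule ccontr)
      assume "\<not> ?thesis"
      then obtain a b where ab: "a \<in> X" "b \<in> Y" "ONL \<sigma>' a = ONL \<sigma> a" "ONL \<sigma>' b = ONL \<sigma> b"
        using V by auto
      then have "ONL \<sigma> a = ONL \<sigma> b" using same[of a] same[of b] by simp
      then show False using cost False ab by simp
    qed
    then have "2 ^ i \<le> card ?D"
      using XY(4,5) card_mono[of ?D X] card_mono[of ?D Y] finite_V by auto
    then show ?thesis using potential_merge_le[OF mrg, of p] by simp
  qed
  moreover have "moves \<sigma>' = moves \<sigma> + card {v \<in> V. ONL \<sigma>' v \<noteq> ONL \<sigma> v}"
    unfolding \<sigma>'_def by (rule moves_snoc)
  ultimately have "(\<Sum>j\<in>{1..<l}. potential p (P' j)) \<le> 2 * moves \<sigma>'" using pot by linarith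
  then show ?thesis using gs' unfolding \<sigma>'_def by blast
qed

text \<open>Edges are distinct subsets of \<open>V\<close>, so a longest sequence satisfying the
  invariant exists. By \<open>adversary_step\<close> it has no block of size at most
  \<open>2 ^ p\<close>, and every group is saturated.\<close>

lemma adversary_wins:
  obtains \<sigma> P where "game_state \<sigma> P" "(l - 1) * (Suc p * 2 ^ p) \<le> 2 * moves \<sigma>"
proof -
  define good where "good \<sigma> \<longleftrightarrow> (\<exists>P. game_state \<sigma> P \<and>
    (\<Sum>j\<in>{1..<l}. potential p (P j)) \<le> 2 * moves \<sigma>)" for \<sigma>
  have zero: "potential p ((\<lambda>v. {v}) ` A) = 0" for A
  proof -
    have "\<not> (2::nat) ^ Suc i \<le> 1" for i using one_less_power[of "2::nat" "Suc i"] by simp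
    then have "big_volume (Suc i) ((\<lambda>v. {v}) ` A) = 0" for i
      unfolding big_volume_def by (intro sum.neutral) auto
    then show ?thesis by (simp add: potential_def)
  qed
  obtain \<sigma>0 where "game_state \<sigma>0 (\<lambda>j. (\<lambda>v. {v}) ` group j)" using initial_game_state .
  then have "good \<sigma>0"
    unfolding good_def by (intro exI[of _ "\<lambda>j. (\<lambda>v. {v}) ` group j"]) (simp add: zero)
  moreover have "\<forall>\<sigma>. good \<sigma> \<longrightarrow> length \<sigma> < Suc (card (Pow V))"
  proof (intro allI impI)
    fix \<sigma> assume "good \<sigma>"
    then obtain P where "game_state \<sigma> P" by (auto simp: good_def)
    note st = game_stateD[OF this]
    have "length \<sigma> = card (set \<sigma>)" using st(1) by (simp add: distinct_card)
    also have "\<dots> \<le> card (Pow V)" using st(2) finite_V by (intro card_mono) auto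
    finally show "length \<sigma> < Suc (card (Pow V))" by simp
  qed
  ultimately obtain \<sigma> where \<sigma>: "good \<sigma>" "\<And>\<rho>. good \<rho> \<Longrightarrow> length \<rho> \<le> length \<sigma>"
    using ex_has_greatest_nat[of good \<sigma>0 length "Suc (card (Pow V))"] by blast
  obtain P where gs: "game_state \<sigma> P"
    and pot: "(\<Sum>j\<in>{1..<l}. potential p (P j)) \<le> 2 * moves \<sigma>"
    using \<sigma>(1) by (auto simp: good_def)
  have "potential p (P j) = Suc p * 2 ^ p" if j: "j \<in> {1..<l}" for j
  proof -
    obtain i where i: "dyadic_level i (P j)" using game_stateD(6)[OF gs j] by auto
    show ?thesis
    proof (rule potential_saturated[OF finite_group[OF j] game_stateD(5)[OF gs j] _ i])
      show "2 ^ p \<le> card (group j)" using card_group[OF j] by simp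
      fix Z assume Z: "Z \<in> P j"
      show "2 ^ p < card Z"
      proof (rule ccontr)
        assume "\<not> 2 ^ p < card Z"
        then obtain e where "good (\<sigma> @ [e])"
          using adversary_step[OF gs pot j Z] unfolding good_def by auto
        then show False using \<sigma>(2)[of "\<sigma> @ [e]"] by simp
      qed
    qed
  qed
  then have "(\<Sum>j\<in>{1..<l}. potential p (P j)) = (l - 1) * (Suc p * 2 ^ p)" by simp
  then show thesis using that[OF gs] pot by simp
qed

lemma schedule_cost_run: "schedule_cost V k \<sigma> (run ONL \<sigma>) = real (moves \<sigma>) / real k"
  by (simp add: schedule_cost_def run_def moves_def sum_divide_distrib)

text \<open>The online side makes at least \<open>(l - 1) * Suc p * 2 ^ p / 2\<close> moves, the
  offline side at most \<open>8 * 2 ^ p\<close>; hence the 16.\<close>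

lemma competitive_ratio_ge:
  "competitive_ratio V l k init ONL \<ge> ennreal (real (l - 1) * real (Suc p) / 16)"
proof -
  obtain \<sigma> P where gs: "game_state \<sigma> P" and m: "(l - 1) * (Suc p * 2 ^ p) \<le> 2 * moves \<sigma>"
    using adversary_wins .
  have "0 < k" using k_ge zero_less_power[of "2::nat" p] by linarith
  have "real ((l - 1) * (Suc p * 2 ^ p)) \<le> real (2 * moves \<sigma>)" using m by (simp only: of_nat_le_iff)
  then have "real (l - 1) * real (Suc p) * 2 ^ p \<le> 2 * real (moves \<sigma>)"
    by (simp add: mult.assoc del: of_nat_Suc mult_Suc)
  then have "real (l - 1) * real (Suc p) / 16 \<le> (real (moves \<sigma>) / real k) / (8 * 2 ^ p / real k)"
    using \<open>0 < k\<close> by (simp add: field_simps del: of_nat_Suc)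
  then have "ennreal (real (l - 1) * real (Suc p) / 16) \<le>
      ennreal (real (moves \<sigma>) / real k) / ennreal (8 * 2 ^ p / real k)"
    using \<open>0 < k\<close> by (subst divide_ennreal) (auto intro: ennreal_leI)
  also have "\<dots> \<le> ennreal (real (moves \<sigma>) / real k) / ennreal (opt_cost V l k init \<sigma>)"
    unfolding divide_ennreal_def
    by (intro mult_left_mono ennreal_inverse_antimono ennreal_leI opt_cost_le[OF gs]) simp
  also have "\<dots> \<le> competitive_ratio V l k init ONL"
    unfolding competitive_ratio_def schedule_cost_run[symmetric]
    by (rule SUP_upper) (rule game_state_requests[OF gs])
  finally show ?thesis .
qed

end

section \<open>Choice of parameters and the final constant\<close>

theorem theorem7p1:
  shows "\<exists>c::real. c > 0 \<and>
    (\<forall>(l::nat) (k::nat) (\<epsilon>::real) (V::nat set) (init::assignment) (ONL::algorithm).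
       l \<ge> 2 \<longrightarrow> k \<ge> 32 \<longrightarrow> 1 / real k \<le> \<epsilon> \<longrightarrow> \<epsilon> \<le> 1 / 32 \<longrightarrow>
       (\<exists>j::nat. \<epsilon> * real k = 2 ^ j) \<longrightarrow>
       finite V \<longrightarrow> card V = l * k \<longrightarrow>
       initial_assignment V l k init \<longrightarrow>
       online_algorithm V l k \<epsilon> init ONL \<longrightarrow>
       competitive_ratio V l k init ONL \<ge> ennreal (c * real l * log 2 (real k)))"
\<comment> \<open>192 is 16 * 2 * 6: the 16 of \<open>competitive_ratio_ge\<close>,
  \<open>l <= 2 * (l - 1)\<close>, and \<open>log 2 k <= p + 6 <= 6 * Suc p\<close>.\<close>
proof (rule exI[of _ "1 / 192"], intro conjI allI impI)
  fix l k :: nat and \<epsilon> :: real and V :: "nat set" and init :: assignment and ONL :: algorithm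
  assume l: "2 \<le> l" and k: "32 \<le> k" and eps: "\<epsilon> \<le> 1 / 32" "\<exists>j::nat. \<epsilon> * real k = 2 ^ j"
    and V: "finite V" and init: "initial_assignment V l k init"
    and onl: "online_algorithm V l k \<epsilon> init ONL"
  obtain p :: nat where p: "2 ^ p \<le> k div 32" "k div 32 < 2 ^ (p + 1)"
    using ex_power_ivl1[of 2 "k div 32"] div_le_mono[OF k, of 32] by auto
  have kp: "32 * 2 ^ p \<le> k" "k < 64 * 2 ^ p" using p by simp_all
  have kp': "real k < 64 * 2 ^ p" using of_nat_less_iff[where 'a = real, THEN iffD2, OF kp(2)] by simp
  \<comment> \<open>Here it matters that \<open>\<epsilon> * k\<close> is a power of two: being
    below \<open>2 ^ Suc p\<close>, it is at most \<open>2 ^ p\<close>.\<close>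
  have slack: "\<epsilon> * real k \<le> 2 ^ p"
  proof -
    obtain j :: nat where j: "\<epsilon> * real k = 2 ^ j" using eps by auto
    have "(2::real) ^ j \<le> real k / 32"
      using mult_right_mono[OF eps(1), of "real k"] by (simp flip: j)
    then have "(2::real) ^ j < 2 ^ Suc p" using kp' by simp
    then have "j < Suc p" by (rule power_less_imp_less_exp[rotated]) simp
    then show ?thesis unfolding j by (simp add: power_increasing)
  qed
  have "\<exists>R. R \<subseteq> {v \<in> V. init v = s} \<and> card R = (if s < 2 then 2 * 2 ^ p else 4 * 2 ^ p)"
    if "s < l" for s
  proof -
    have "card {v \<in> V. init v = s} = k"
      using init that by (simp add: initial_assignment_def load_def)
    then have "(if s < 2 then 2 * 2 ^ p else 4 * 2 ^ p) \<le> card {v \<in> V. init v = s}"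
      using kp(1) by simp
    then obtain R where "R \<subseteq> {v \<in> V. init v = s}"
        "card R = (if s < 2 then 2 * 2 ^ p else 4 * 2 ^ p)" "finite R"
      by (rule obtain_subset_with_card_n)
    then show ?thesis by (intro exI[of _ R] conjI)
  qed
  then obtain Q where Q: "\<And>s. s < l \<Longrightarrow> Q s \<subseteq> {v \<in> V. init v = s}"
      "\<And>s. s < l \<Longrightarrow> card (Q s) = (if s < 2 then 2 * 2 ^ p else 4 * 2 ^ p)"
    by metis
  interpret partition_adversary V l k init p Q ONL
  proof unfold_locales
    fix \<sigma> assume "\<sigma> \<in> requests V l k"
    then have "valid_assignment V l ((1 + \<epsilon>) * real k) (set \<sigma>) (ONL \<sigma>)"
      using onl by (fastforce simp: online_algorithm_def valid_schedule_def run_def)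
    moreover have "(1 + \<epsilon>) * real k \<le> real (k + 2 ^ p)" using slack by (simp add: algebra_simps)
    ultimately show "valid_assignment V l (real (k + 2 ^ p)) (set \<sigma>) (ONL \<sigma>)"
      unfolding valid_assignment_def by (meson order_trans)
  qed (use V l kp(1) init Q in auto)
  have "real k \<le> 2 ^ (p + 6)"
    using kp' by (simp add: power_add)
  then have "log 2 (real k) \<le> real (p + 6)"
    using k by (subst log_le_iff) (simp_all add: powr_realpow del: of_nat_add)
  also have "\<dots> \<le> 6 * real (Suc p)" by simp
  finally have "real l * log 2 (real k) \<le> (2 * real (l - 1)) * (6 * real (Suc p))"
    using l k by (intro mult_mono) auto
  then have "1 / 192 * real l * log 2 (real k) \<le> real (l - 1) * real (Suc p) / 16"
    by (simp add: algebra_simps del: of_nat_Suc)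
  then show "ennreal (1 / 192 * real l * log 2 (real k)) \<le> competitive_ratio V l k init ONL"
    using competitive_ratio_ge by (meson ennreal_leI order_trans)
qed simp

end
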